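(* Let $p\ge 1$, let $m\in\mathbb{R}^p$, let $S$ be a symmetric positive semidefinite real $p\times p$ matrix, and let $\mathcal{C}\subseteq\mathbb{R}^p$ be a nonempty closed (not necessarily convex) cone such that $\lambda' S\lambda>0$ for all $\lambda\in\mathcal{C}\setminus\{0\}$. Let $\mathcal{S}^0=\{\lambda\in\mathbb{R}^p : \lambda' S\lambda=1\}\cup\{0\}$. Suppose that $$\widehat{\beta}=\arg\min_{\beta\in\mathcal{C}}\; \bigl(1-2m'\beta+\beta' S\beta\bigr)\qquad\text{and}\qquad \widehat{\lambda}=\arg\max_{\lambda\in\mathcal{S}^0\cap\mathcal{C}} m'\lambda$$ are unique optimizers (i.e. each optimization problem has exactly one optimizer, denoted $\widehat\beta$ and $\widehat\lambda$ respectively). Then $$\widehat{\lambda}=\frac{\widehat{\beta}}{\sqrt{\widehat{\beta}' S\widehat{\beta}}}\quad\text{if }\widehat{\beta}\neq 0,\qquad\text{and}\qquad \widehat{\lambda}=0\quad\text{otherwise.}$$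
   Context: A cone in $\mathbb{R}^p$ is a set $\mathcal{C}\subseteq\mathbb{R}^p$ closed under multiplication by positive scalars: if $\lambda\in\mathcal{C}$ then $\gamma\lambda\in\mathcal{C}$ for all $\gamma>0$. A prime denotes transpose. The maximal value $T_{\mathcal{C}}=\max_{\lambda\in\mathcal{S}^0\cap\mathcal{C}} m'\lambda$ is called the conic statistic. *)

theory Defs
  imports "HOL-Analysis.Analysis"
begin

(* Scaling by strictly positive factors only, so that 0 need not belong to the set; the library's
   predicates cone and conic allow the factor 0 as well. *)
definition pos_cone :: "'a::real_vector set \<Rightarrow> bool"
  where "pos_cone C \<longleftrightarrow> (\<forall>x\<in>C. \<forall>c>0. c *\<^sub>R x \<in> C)"

definition pos_semidef :: "real^'n^'n \<Rightarrow> bool"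
  where "pos_semidef S \<longleftrightarrow> transpose S = S \<and> (\<forall>x. x \<bullet> (S *v x) \<ge> 0)"

definition unit_shell :: "real^'n^'n \<Rightarrow> (real^'n) set"
  where "unit_shell S = {l. l \<bullet> (S *v l) = 1} \<union> {0}"

definition unique_arg_min :: "('a \<Rightarrow> real) \<Rightarrow> ('a \<Rightarrow> bool) \<Rightarrow> 'a \<Rightarrow> bool"
  where "unique_arg_min f P x \<longleftrightarrow> is_arg_min f P x \<and> (\<forall>y. is_arg_min f P y \<longrightarrow> y = x)"

definition unique_arg_max :: "('a \<Rightarrow> real) \<Rightarrow> ('a \<Rightarrow> bool) \<Rightarrow> 'a \<Rightarrow> bool"
  where "unique_arg_max f P x \<longleftrightarrow> is_arg_max f P x \<and> (\<forall>y. is_arg_max f P y \<longrightarrow> y = x)"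

end

theory Submission
  imports Defs
begin

text \<open>
  The quadratic objective is minimized in polar form: every nonzero point of \<open>C\<close> is \<open>c l\<close> with
  \<open>c > 0\<close> and \<open>l' S l = 1\<close>, and completing the square in \<open>c\<close> gives the value
  \<open>1 - (m' l)\<^sup>2 + (c - m' l)\<^sup>2\<close> (lemma \<open>quadratic_loss_along_ray\<close>). On a ray with \<open>m' l > 0\<close> the
  choice \<open>c = m' l\<close> attains \<open>1 - (m' l)\<^sup>2\<close>, so minimizing the loss amounts to making a positive
  \<open>m' l\<close> as large as possible. The value \<open>1\<close> at the origin, which closedness puts into \<open>C\<close>,
  corresponds to the value \<open>0\<close> of the maximization: if the loss is minimal at the origin, no ray
  has \<open>m' l > 0\<close>; otherwise the direction of the minimizer satisfies \<open>m' l > 0\<close>, and no other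
  ray has a larger \<open>m' l\<close>.
  In both cases the claimed vector is thus a maximizer, and uniqueness identifies it with
  \<open>lambda_hat\<close>.
\<close>

lemma zero_in_closed_pos_cone:
  fixes C :: "'a::real_normed_vector set"
  assumes "closed C" "pos_cone C" "x \<in> C"
  shows "0 \<in> C"
proof -
  have mem: "inverse (real (Suc n)) *\<^sub>R x \<in> C" for n
    using assms(2,3) by (simp add: pos_cone_def)
  have "(\<lambda>n. inverse (real (Suc n)) *\<^sub>R x) \<longlonglongrightarrow> 0 *\<^sub>R x"
    by (intro tendsto_intros LIMSEQ_inverse_real_of_nat)
  then show ?thesis
    using closed_sequentially[OF assms(1), of "\<lambda>n. inverse (real (Suc n)) *\<^sub>R x"] mem
    by (metis scaleR_zero_left)
qed

lemma quadratic_form_scaleR: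
  fixes S :: "real^'n^'n"
  shows "(c *\<^sub>R l) \<bullet> (S *v (c *\<^sub>R l)) = c\<^sup>2 * (l \<bullet> (S *v l))"
  by (simp add: matrix_vector_mult_scaleR power2_eq_square)

text \<open>
  Completing the square in the radius \<open>c\<close>: the direction \<open>l\<close> enters only through \<open>m \<bullet> l\<close>.
\<close>

lemma quadratic_loss_along_ray:
  fixes S :: "real^'n^'n"
  assumes "l \<bullet> (S *v l) = 1"
  shows "1 - 2 * (m \<bullet> (c *\<^sub>R l)) + (c *\<^sub>R l) \<bullet> (S *v (c *\<^sub>R l))
           = 1 - (m \<bullet> l)\<^sup>2 + (c - m \<bullet> l)\<^sup>2"
  unfolding quadratic_form_scaleR assms by (simp add: power2_eq_square algebra_simps)

text \<open>
  A lower bound \<open>v\<close> for the loss on the cone is tested at the best radius \<open>c = m \<bullet> l\<close> of each ray,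
  which is an admissible scaling only if it is positive.
\<close>

lemma loss_lower_bound_imp_slope_bound:
  fixes S :: "real^'n^'n"
  assumes cone: "pos_cone C" and l: "l \<in> C" "l \<bullet> (S *v l) = 1"
    and lower: "\<And>b. b \<in> C \<Longrightarrow> v \<le> 1 - 2 * (m \<bullet> b) + b \<bullet> (S *v b)"
    and pos: "m \<bullet> l > 0"
  shows "(m \<bullet> l)\<^sup>2 \<le> 1 - v"
proof -
  have "(m \<bullet> l) *\<^sub>R l \<in> C"
    using cone l(1) pos by (simp add: pos_cone_def)
  from lower[OF this] show ?thesis
    unfolding quadratic_loss_along_ray[OF l(2)] by simp
qed

lemma unique_arg_max_eqI:
  assumes "unique_arg_max f P x" "P y" "\<And>z. P z \<Longrightarrow> f z \<le> f y"
  shows "x = y"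
proof -
  have "is_arg_max f P y"
    using assms(2,3) by (auto simp: is_arg_max_def not_less)
  then show ?thesis
    using assms(1) by (auto simp: unique_arg_max_def)
qed

theorem proposition1:
  fixes m :: "real^'p" and S :: "real^'p^'p" and C :: "(real^'p) set"
    and beta_hat lambda_hat :: "real^'p"
  assumes "pos_semidef S"
    and "C \<noteq> {}" and "closed C" and "pos_cone C"
    and "\<And>l. l \<in> C - {0} \<Longrightarrow> l \<bullet> (S *v l) > 0"
    and "unique_arg_min (\<lambda>b. 1 - 2 * (m \<bullet> b) + b \<bullet> (S *v b)) (\<lambda>b. b \<in> C) beta_hat"
    and "unique_arg_max (\<lambda>l. m \<bullet> l) (\<lambda>l. l \<in> unit_shell S \<inter> C) lambda_hat"
  shows "(beta_hat \<noteq> 0 \<longrightarrow>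
            lambda_hat = (1 / sqrt (beta_hat \<bullet> (S *v beta_hat))) *\<^sub>R beta_hat) \<and>
         (beta_hat = 0 \<longrightarrow> lambda_hat = 0)"
proof -
  let ?q = "\<lambda>b. b \<bullet> (S *v b)"
  let ?f = "\<lambda>b. 1 - 2 * (m \<bullet> b) + ?q b"
  have beta_C: "beta_hat \<in> C" and min: "\<And>b. b \<in> C \<Longrightarrow> ?f beta_hat \<le> ?f b"
    using assms(6) by (auto simp: unique_arg_min_def is_arg_min_def not_less)
  have zero_C: "0 \<in> C"
    using zero_in_closed_pos_cone[OF assms(3,4) beta_C] .
  have slope_bound: "(m \<bullet> l)\<^sup>2 \<le> 1 - ?f beta_hat"
    if "l \<in> C" "?q l = 1" "m \<bullet> l > 0" for l
    using loss_lower_bound_imp_slope_bound[OF assms(4) that(1,2) min that(3)] .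
  show ?thesis
  proof (intro conjI impI)
    assume nz: "beta_hat \<noteq> 0"
    define s where "s = ?q beta_hat"
    define l0 where "l0 = (1 / sqrt s) *\<^sub>R beta_hat"
    have s: "s > 0"
      using assms(5) beta_C nz by (simp add: s_def)
    have q_l0: "?q l0 = 1"
      unfolding l0_def quadratic_form_scaleR s_def[symmetric] using s by (simp add: power_divide)
    have l0_C: "l0 \<in> C"
      using assms(4) beta_C s by (simp add: pos_cone_def l0_def)
    \<comment> \<open>The minimum does not exceed the loss at the origin.\<close>
    have "s \<le> 2 * (m \<bullet> beta_hat)"
      using min[OF zero_C] by (simp add: s_def)
    then have l0_pos: "m \<bullet> l0 > 0"
      using s by (simp add: l0_def)
    have "sqrt s *\<^sub>R l0 = beta_hat"
      using s by (simp add: l0_def)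
    then have "?f beta_hat = 1 - (m \<bullet> l0)\<^sup>2 + (sqrt s - m \<bullet> l0)\<^sup>2"
      using quadratic_loss_along_ray[OF q_l0, of m "sqrt s"] by (simp only:)
    then have f_beta: "1 - ?f beta_hat \<le> (m \<bullet> l0)\<^sup>2"
      using zero_le_power2[of "sqrt s - m \<bullet> l0"] by linarith
    have "m \<bullet> l \<le> m \<bullet> l0" if "l \<in> unit_shell S \<inter> C" for l
    proof (cases "m \<bullet> l > 0")
      case True
      then have "?q l = 1" "l \<in> C"
        using that by (auto simp: unit_shell_def)
      then have "(m \<bullet> l)\<^sup>2 \<le> (m \<bullet> l0)\<^sup>2"
        using slope_bound[OF _ _ True] f_beta by linarith
      then show ?thesis
        using power2_le_imp_le l0_pos less_imp_le by blast
    qed (use l0_pos in linarith)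
    moreover have "l0 \<in> unit_shell S \<inter> C"
      using q_l0 l0_C by (simp add: unit_shell_def)
    ultimately have "lambda_hat = l0"
      using unique_arg_max_eqI[OF assms(7)] by blast
    then show "lambda_hat = (1 / sqrt (?q beta_hat)) *\<^sub>R beta_hat"
      by (simp add: l0_def s_def)
  next
    assume zero: "beta_hat = 0"
    have "m \<bullet> l \<le> m \<bullet> 0" if "l \<in> unit_shell S \<inter> C" for l
    proof (rule ccontr)
      assume "\<not> ?thesis"
      then have pos: "m \<bullet> l > 0"
        by simp
      then have "?q l = 1" "l \<in> C"
        using that by (auto simp: unit_shell_def)
      from slope_bound[OF this(2,1) pos] pos show False
        by (simp add: zero)
    qed
    moreover have "0 \<in> unit_shell S \<inter> C"
      using zero_C by (simp add: unit_shell_def)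
    ultimately show "lambda_hat = 0"
      using unique_arg_max_eqI[OF assms(7)] by blast
  qed
qed

end
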